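(* Let $T:\mathcal H\otimes\mathbb C^d\to\mathcal H$ be a row contraction. (a) $T$ is CNC if and only if $\mathcal H=\bigvee_{\alpha\in\mathbb F^d}T^\alpha\,\mathrm{Ran}(D_{T^*})$. (b) If $T$ is a $d$-contraction, then $T$ is CNC if and only if $$\mathcal H=\bigvee_{\mathbf n\in\mathbb N^d}T^{\mathbf n}\,\mathrm{Ran}(D_{T^*})=\bigvee_{z\in\mathbb B^d}(I-Tz^* )^{-1}\mathrm{Ran}(D_{T^*}).$$ (c) In particular, if a (not necessarily commutative) row contraction $T$ satisfies $\mathcal H=\bigvee_{z\in\mathbb B^d}(I-Tz^* )^{-1}\mathrm{Ran}(D_{T^*})$, then $T$ is CNC.
   Context: $\mathcal H$ is a complex separable (or finite-dimensional) Hilbert space, $d\in\mathbb N$, $\mathbb B^d$ the open unit ball of $\mathbb C^d$, $\bigvee$ closed linear span. A row contraction is a contraction $T=(T_1,\dots,T_d):\mathcal H\otimes\mathbb C^d\to\mathcal H$, $T(h_1,\dots,h_d)^T=\sum T_jh_j$; it is a $d$-contraction if $T_1,\dots,T_d$ mutually commute. $Tz^*:=\sum_j\overline z_jT_j$ for $z\in\mathbb B^d$. $D_{T^*}:=\sqrt{I-TT^*}$. $T$ is completely non-coisometric (CNC) if there is no non-trivial subspace $\mathcal H'\subseteq\mathcal H$ that is co-invariant for every $T_k$ (i.e. $T_k^*\mathcal H'\subseteq\mathcal H'$) and such that $T^*|_{\mathcal H'}$ is an isometry of $\mathcal H'$ into $\mathcal H'\otimes\mathbb C^d$. $\mathbb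 F^d$ is the free unital semigroup (words) on the letters $1,\dots,d$; for $\alpha=i_1\cdots i_k$, $T^\alpha:=T_{i_1}\cdots T_{i_k}$ ($T^\emptyset=I$). $\mathbb N^d$ is the set of $d$-tuples of non-negative integers and $\lambda:\mathbb F^d\to\mathbb N^d$ counts how often each letter occurs in a word; $T^{\mathbf n}:=\sum_{\alpha:\lambda(\alpha)=\mathbf n}T^\alpha$. *)

theory Defs
  imports "HOL-Analysis.Analysis"
begin

section \<open>Complex inner product spaces\<close>

text \<open>
  The inner product is linear in the first argument and conjugate-linear in the second. The class
  extends \<open>real_inner\<close>, so norm and topology are the ones induced by the real part of
  \<open>cinner\<close>, which is also the norm induced by \<open>cinner\<close> itself. Complex Hilbert spaces are the types
  of sort \<open>{complex_inner, complete_space}\<close>; the zero space is not excluded.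
\<close>

class complex_inner = real_inner +
  fixes scaleC :: "complex \<Rightarrow> 'a \<Rightarrow> 'a"
    and cinner :: "'a \<Rightarrow> 'a \<Rightarrow> complex"
  assumes scaleC_add_right: "scaleC a (x + y) = scaleC a x + scaleC a y"
    and scaleC_add_left: "scaleC (a + b) x = scaleC a x + scaleC b x"
    and scaleC_scaleC: "scaleC a (scaleC b x) = scaleC (a * b) x"
    and scaleC_of_real: "scaleC (complex_of_real r) x = r *\<^sub>R x"
    and cinner_commute: "cinner x y = cnj (cinner y x)"
    and cinner_add_left: "cinner (x + y) z = cinner x z + cinner y z"
    and cinner_scaleC_left: "cinner (scaleC a x) y = a * cinner x y"
    and inner_eq_Re_cinner: "inner x y = Re (cinner x y)"

global_interpretation complex_vector: vector_space "scaleC :: complex \<Rightarrow> 'a \<Rightarrow> 'a::complex_inner"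
  defines cspan = complex_vector.span
    and csubspace = complex_vector.subspace
proof
  show "scaleC 1 x = x" for x :: 'a
    using scaleC_of_real[of 1 x] by simp
qed (simp_all add: scaleC_add_right scaleC_add_left scaleC_scaleC)

instantiation complex :: complex_inner
begin

definition scaleC_complex :: "complex \<Rightarrow> complex \<Rightarrow> complex"
  where "scaleC_complex a x = a * x"

definition cinner_complex :: "complex \<Rightarrow> complex \<Rightarrow> complex"
  where "cinner_complex x y = x * cnj y"

instance
  by standard
    (simp_all add: scaleC_complex_def cinner_complex_def algebra_simps scaleR_conv_of_real
      inner_complex_def)

end

text \<open>
  The Hilbert space tensor product of \<open>\<H>\<close> with \<open>\<complex>\<^sup>d\<close> is the space of column vectors
  \<open>'h ^ 'd\<close>, whose library norm is the \<open>\<ell>\<^sup>2\<close> norm.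
\<close>

instantiation vec :: (complex_inner, finite) complex_inner
begin

definition scaleC_vec :: "complex \<Rightarrow> 'a ^ 'b \<Rightarrow> 'a ^ 'b"
  where "scaleC_vec a x = (\<chi> i. scaleC a (x $ i))"

definition cinner_vec :: "'a ^ 'b \<Rightarrow> 'a ^ 'b \<Rightarrow> complex"
  where "cinner_vec x y = (\<Sum>i\<in>UNIV. cinner (x $ i) (y $ i))"

instance
proof
  fix a b :: complex and r :: real and x y z :: "'a ^ 'b"
  show "scaleC a (x + y) = scaleC a x + scaleC a y"
    by (simp add: vec_eq_iff scaleC_vec_def scaleC_add_right)
  show "scaleC (a + b) x = scaleC a x + scaleC b x"
    by (simp add: vec_eq_iff scaleC_vec_def scaleC_add_left)
  show "scaleC a (scaleC b x) = scaleC (a * b) x"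
    by (simp add: vec_eq_iff scaleC_vec_def scaleC_scaleC)
  show "scaleC (complex_of_real r) x = r *\<^sub>R x"
    by (simp add: vec_eq_iff scaleC_vec_def scaleC_of_real)
  show "cinner x y = cnj (cinner y x)"
    unfolding cinner_vec_def cnj_sum by (intro sum.cong refl cinner_commute)
  show "cinner (x + y) z = cinner x z + cinner y z"
    by (simp add: cinner_vec_def cinner_add_left sum.distrib)
  show "cinner (scaleC a x) y = a * cinner x y"
    by (simp add: cinner_vec_def scaleC_vec_def cinner_scaleC_left sum_distrib_left)
  show "inner x y = Re (cinner x y)"
    by (simp add: inner_vec_def cinner_vec_def inner_eq_Re_cinner)
qed

end

definition closed_cspan :: "'a::complex_inner set \<Rightarrow> 'a set"
  where "closed_cspan S = closure (cspan S)"


section \<open>Operators\<close>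

definition clinear :: "('a::complex_inner \<Rightarrow> 'b::complex_inner) \<Rightarrow> bool"
  where "clinear f \<longleftrightarrow> Vector_Spaces.linear scaleC scaleC f"

text \<open>
  As for the library's \<open>adjoint\<close>, the adjoint is chosen by its defining property, which
  determines it uniquely; it exists for bounded operators between Hilbert spaces.
\<close>

definition cadjoint :: "('a::complex_inner \<Rightarrow> 'b::complex_inner) \<Rightarrow> 'b \<Rightarrow> 'a"
  where "cadjoint f = (SOME g. \<forall>x y. cinner (f x) y = cinner x (g y))"

definition positive_op :: "('a::complex_inner \<Rightarrow> 'a) \<Rightarrow> bool"
  where "positive_op A \<longleftrightarrow>
    clinear A \<and> bounded_linear A \<and> (\<forall>x. cinner (A x) x \<in> \<real> \<and> 0 \<le> Re (cinner (A x) x))"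

text \<open>On a Hilbert space, a positive operator has exactly one positive square root.\<close>

definition sqrt_op :: "('a::complex_inner \<Rightarrow> 'a) \<Rightarrow> 'a \<Rightarrow> 'a"
  where "sqrt_op A = (SOME S. positive_op S \<and> S \<circ> S = A)"


section \<open>Row contractions\<close>

text \<open>A row \<open>(T\<^sub>1, \<dots>, T\<^sub>d)\<close> is a family indexed by a finite type \<open>'d\<close> with \<open>d\<close> elements.\<close>

definition row_op :: "('d::finite \<Rightarrow> 'h::complex_inner \<Rightarrow> 'h) \<Rightarrow> 'h ^ 'd \<Rightarrow> 'h"
  where "row_op T v = (\<Sum>j\<in>UNIV. T j (v $ j))"

definition row_contraction :: "('d::finite \<Rightarrow> 'h::complex_inner \<Rightarrow> 'h) \<Rightarrow> bool"
  where "row_contraction T \<longleftrightarrow> (\<forall>j. clinear (T j)) \<and> (\<forall>v. norm (row_op T v) \<le> norm v)"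

definition d_contraction :: "('d::finite \<Rightarrow> 'h::complex_inner \<Rightarrow> 'h) \<Rightarrow> bool"
  where "d_contraction T \<longleftrightarrow> row_contraction T \<and> (\<forall>i j. T i \<circ> T j = T j \<circ> T i)"

text \<open>\<open>row_eval T z\<close> is \<open>T z\<^sup>*\<close>.\<close>

definition row_eval :: "('d::finite \<Rightarrow> 'h::complex_inner \<Rightarrow> 'h) \<Rightarrow> complex ^ 'd \<Rightarrow> 'h \<Rightarrow> 'h"
  where "row_eval T z h = (\<Sum>j\<in>UNIV. scaleC (cnj (z $ j)) (T j h))"

text \<open>\<open>defect_star T\<close> is \<open>D\<close> with index \<open>T\<^sup>*\<close>, the positive square root of \<open>I - T T\<^sup>*\<close>.\<close>

definition defect_star :: "('d::finite \<Rightarrow> 'h::complex_inner \<Rightarrow> 'h) \<Rightarrow> 'h \<Rightarrow> 'h"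
  where "defect_star T = sqrt_op (\<lambda>h. h - row_op T (cadjoint (row_op T) h))"

text \<open>
  The whole space counts as a non-trivial subspace (unless it is zero). Closedness of the subspace
  is not required; this makes no difference, since for a row contraction \<open>T\<close> both conditions pass
  to the closure.
\<close>

definition CNC :: "('d::finite \<Rightarrow> 'h::complex_inner \<Rightarrow> 'h) \<Rightarrow> bool"
  where "CNC T \<longleftrightarrow>
    \<not> (\<exists>M. csubspace M \<and> M \<noteq> {0} \<and>
          (\<forall>k. cadjoint (T k) ` M \<subseteq> M) \<and>
          (\<forall>h\<in>M. norm (cadjoint (row_op T) h) = norm h))"

text \<open>Words over the letters \<open>'d\<close> are lists; the empty word gives the identity.\<close>

definition word_power :: "('d \<Rightarrow> 'h \<Rightarrow> 'h) \<Rightarrow> 'd list \<Rightarrow> 'h \<Rightarrow> 'h"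
  where "word_power T \<alpha> = foldr (\<lambda>i S. T i \<circ> S) \<alpha> id"

definition letter_count :: "'d::finite list \<Rightarrow> nat ^ 'd"
  where "letter_count \<alpha> = (\<chi> i. count_list \<alpha> i)"

definition multi_power :: "('d::finite \<Rightarrow> 'h::complex_inner \<Rightarrow> 'h) \<Rightarrow> nat ^ 'd \<Rightarrow> 'h \<Rightarrow> 'h"
  where "multi_power T n h = (\<Sum>\<alpha> | letter_count \<alpha> = n. word_power T \<alpha> h)"

text \<open>The sum defining \<open>multi_power\<close> is a sum over a finite set.\<close>

lemma finite_letter_count: "finite {\<alpha>. letter_count \<alpha> = (n :: nat ^ 'd::finite)}"
proof (rule finite_subset)
  have "length \<alpha> = (\<Sum>i\<in>UNIV. count_list \<alpha> i)" for \<alpha> :: "'d list"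
    by (subst sum_count_set) auto
  then show "{\<alpha>. letter_count \<alpha> = n}
      \<subseteq> {\<alpha>. set \<alpha> \<subseteq> UNIV \<and> length \<alpha> = (\<Sum>i\<in>UNIV. n $ i)}"
    by (auto simp: letter_count_def)
qed (rule finite_lists_length_eq, simp)

end

theory Submission
  imports Defs
begin

text \<open>
  For a row contraction \<open>T\<close> with defect operator \<open>D\<close>, self-adjointness of \<open>D\<close> and
  \<open>\<parallel>D h\<parallel>\<^sup>2 = \<parallel>h\<parallel>\<^sup>2 - \<parallel>T\<^sup>* h\<parallel>\<^sup>2\<close> show that the orthogonal complement of all \<open>T\<^sup>\<alpha> Ran D\<close> is the
  largest co-invariant subspace on which \<open>T\<^sup>*\<close> is isometric; this is (a). The closed span of
  the \<open>T\<^sup>\<alpha> Ran D\<close> is invariant under \<open>T z\<^sup>*\<close>, hence under the resolvent (Banach's fixed point theorem),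
  which gives (c). Conversely, a closed subspace containing \<open>(I - T z\<^sup>*)\<^sup>-\<^sup>1 y\<close> for all \<open>z\<close> in the ball
  contains \<open>(T z\<^sup>*)\<^sup>k y\<close> for all \<open>z\<close> and \<open>k\<close>; if the \<open>T\<^sub>i\<close> commute, the derivative in direction
  \<open>e\<^sub>i\<close> at \<open>z\<close> is \<open>k T\<^sub>i (T z\<^sup>*)\<^sup>k\<^sup>-\<^sup>1 y\<close>, and iterating produces all \<open>T\<^sup>\<alpha> y\<close>, which gives (b).
\<close>


section \<open>Orthogonal complements and adjoints\<close>

lemma cinner_add_right: "cinner x (y + z) = cinner x y + cinner x z"
  by (metis cinner_add_left cinner_commute complex_cnj_add)

lemma cinner_scaleC_right: "cinner x (scaleC a y) = cnj a * cinner x y"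
  by (metis cinner_scaleC_left cinner_commute complex_cnj_mult)

lemma cinner_zero_left [simp]: "cinner 0 x = 0"
  using cinner_add_left[of 0 0 x] by simp

lemma cinner_zero_right [simp]: "cinner x 0 = 0"
  using cinner_add_right[of x 0 0] by simp

lemma cinner_diff_left: "cinner (x - y) z = cinner x z - cinner y z"
  using cinner_add_left[of "x - y" y z] by simp

lemma cinner_diff_right: "cinner x (y - z) = cinner x y - cinner x z"
  using cinner_add_right[of x "y - z" z] by simp

lemma cinner_sum_left: "cinner (\<Sum>i\<in>I. f i) y = (\<Sum>i\<in>I. cinner (f i) y)"
  by (induction I rule: infinite_finite_induct) (simp_all add: cinner_add_left)

text \<open>Reduces the complex inner product to real ones, from which its continuity is inherited.
  The imaginary part comes from conjugate-linearity in the second argument.\<close>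

lemma cinner_conv_inner: "cinner x y = Complex (inner x y) (inner x (scaleC \<i> y))"
  by (simp add: inner_eq_Re_cinner cinner_scaleC_right complex_eq_iff)

lemma cinner_self: "cinner x x = of_real ((norm x)\<^sup>2)"
proof -
  have "Im (cinner x x) = 0"
    using cinner_commute[of x x] by (simp add: complex_eq_iff)
  then show ?thesis
    by (simp add: complex_eq_iff power2_norm_eq_inner inner_eq_Re_cinner)
qed

lemma cinner_self_eq_0_iff [simp]: "cinner x x = 0 \<longleftrightarrow> x = 0"
  by (simp add: cinner_self)

lemma cinner_left_eqI: "(\<And>x. cinner x y = cinner x z) \<Longrightarrow> y = z"
  by (metis cinner_diff_right cinner_self_eq_0_iff eq_iff_diff_eq_0)

text \<open>The class ties the norm to real scalars only; homogeneity for complex scalars comes from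
  \<open>cinner x x\<close> being the squared norm.\<close>

lemma norm_scaleC: "norm (scaleC a x) = cmod a * norm x"
proof -
  have "complex_of_real ((norm (scaleC a x))\<^sup>2) = a * cnj a * cinner x x"
    unfolding cinner_self[symmetric] by (simp add: cinner_scaleC_left cinner_scaleC_right del: cinner_self_eq_0_iff)
  also have "\<dots> = of_real ((cmod a * norm x)\<^sup>2)"
    by (simp add: cinner_self power_mult_distrib complex_norm_square[symmetric])
  finally show ?thesis
    by (simp only: of_real_eq_iff) (simp add: power2_eq_iff_nonneg)
qed

lemma bounded_linear_scaleC: "bounded_linear (scaleC a)"
proof
  show "scaleC a (r *\<^sub>R x) = r *\<^sub>R scaleC a x" for r x
    by (simp add: scaleC_scaleC mult.commute flip: scaleC_of_real)
  show "\<exists>K. \<forall>x. norm (scaleC a x) \<le> norm x * K"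
    by (rule exI[of _ "cmod a"]) (simp add: norm_scaleC)
qed (rule scaleC_add_right)

lemma continuous_on_cinner [continuous_intros]:
  fixes f g :: "'a::topological_space \<Rightarrow> 'b::complex_inner"
  assumes "continuous_on S f" "continuous_on S g"
  shows "continuous_on S (\<lambda>x. cinner (f x) (g x))"
  unfolding cinner_conv_inner Complex_eq
  by (intro continuous_intros assms bounded_linear.continuous_on[OF bounded_linear_scaleC])

section \<open>Closed complex subspaces, closed spans and orthogonality\<close>

lemma csubspace_closure:
  fixes S :: "'a::complex_inner set"
  assumes "csubspace S"
  shows "csubspace (closure S)"
proof (rule complex_vector.subspaceI)
  show "0 \<in> closure S"
    using complex_vector.subspace_0[OF assms] closure_subset by blast
next
  fix x y assume "x \<in> closure S" "y \<in> closure S"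
  then obtain u v where *: "\<And>n. u n \<in> S" "u \<longlonglongrightarrow> x" "\<And>n. v n \<in> S" "v \<longlonglongrightarrow> y"
    unfolding closure_sequential by blast
  have "u n + v n \<in> S" for n
    by (intro complex_vector.subspace_add assms *)
  moreover have "(\<lambda>n. u n + v n) \<longlonglongrightarrow> x + y"
    by (intro tendsto_add *)
  ultimately show "x + y \<in> closure S"
    unfolding closure_sequential by (intro exI[of _ "\<lambda>n. u n + v n"]) blast
next
  fix c x assume "x \<in> closure S"
  then obtain u where *: "\<And>n. u n \<in> S" "u \<longlonglongrightarrow> x"
    unfolding closure_sequential by blast
  have "scaleC c (u n) \<in> S" for n
    by (intro complex_vector.subspace_scale assms *)
  moreover have "(\<lambda>n. scaleC c (u n)) \<longlonglongrightarrow> scaleC c x"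
    by (intro bounded_linear.tendsto[OF bounded_linear_scaleC] *)
  ultimately show "scaleC c x \<in> closure S"
    unfolding closure_sequential by (intro exI[of _ "\<lambda>n. scaleC c (u n)"]) blast
qed

lemma csubspace_closed_cspan: "csubspace (closed_cspan S)"
  unfolding closed_cspan_def by (intro csubspace_closure complex_vector.subspace_span)

lemma closed_closed_cspan: "closed (closed_cspan S)"
  by (simp add: closed_cspan_def)

lemma closed_cspan_superset: "S \<subseteq> closed_cspan S"
  unfolding closed_cspan_def using complex_vector.span_superset closure_subset by blast

lemma closed_cspan_minimal:
  "S \<subseteq> L \<Longrightarrow> csubspace L \<Longrightarrow> closed L \<Longrightarrow> closed_cspan S \<subseteq> L"
  unfolding closed_cspan_def by (intro closure_minimal complex_vector.span_minimal)

lemma csubspace_scaleR: "csubspace L \<Longrightarrow> x \<in> L \<Longrightarrow> r *\<^sub>R x \<in> L"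
  by (metis complex_vector.subspace_scale scaleC_of_real)

text \<open>Projection theorem: a point \<open>y\<close> outside \<open>L\<close> has a nearest
  point \<open>p\<close> in \<open>L\<close>, and \<open>y - p\<close> is the required vector.
  Completeness enters through nested closed sets with shrinking diameters.\<close>

lemma closed_csubspace_perp_exists:
  fixes L :: "'a::{complex_inner, complete_space} set"
  assumes L: "csubspace L" and "closed L" and "L \<noteq> UNIV"
  obtains h where "h \<noteq> 0" "\<And>x. x \<in> L \<Longrightarrow> cinner x h = 0"
proof -
  obtain y where y: "y \<notin> L"
    using \<open>L \<noteq> UNIV\<close> by blast
  have ne: "L \<noteq> {}"
    using complex_vector.subspace_0[OF L] by blast
  define \<delta> where "\<delta> = infdist y L"
  have d: "\<delta> \<le> norm (y - x)" if "x \<in> L" for x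
    using infdist_le[OF that, of y] by (simp add: \<delta>_def dist_norm)
  have "\<delta> \<ge> 0"
    by (simp add: \<delta>_def infdist_nonneg)
  \<comment> \<open>The points of \<open>L\<close> that are nearly closest to \<open>y\<close>;
    their intersection will be the single minimiser.\<close>
  define S where "S n = L \<inter> {x. (norm (y - x))\<^sup>2 \<le> \<delta>\<^sup>2 + 1 / real (Suc n)}" for n
  have "\<exists>a. \<Inter>(range S) = {a}"
  proof (rule decreasing_closed_nest_sing)
    show "closed (S n)" for n
      unfolding S_def by (intro closed_Int \<open>closed L\<close> closed_Collect_le continuous_intros)
  next
    fix n
    have "\<delta> < sqrt (\<delta>\<^sup>2 + 1 / real (Suc n))"
      using \<open>\<delta> \<ge> 0\<close> by (intro real_less_rsqrt) auto
    then obtain x where "x \<in> L" "dist y x < sqrt (\<delta>\<^sup>2 + 1 / real (Suc n))"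
      using cInf_lessD[of "dist y ` L"] ne by (auto simp: \<delta>_def infdist_def)
    then have "x \<in> S n"
      unfolding S_def dist_norm by (auto intro: sqrt_ge_absD simp del: of_nat_Suc)
    then show "S n \<noteq> {}" by blast
  next
    show "S n \<subseteq> S m" if "m \<le> n" for m n
      using that unfolding S_def
      by (auto elim!: order_trans simp: frac_le)
  next
    fix \<epsilon> :: real assume "\<epsilon> > 0"
    \<comment> \<open>By the parallelogram law and the midpoint lying in \<open>L\<close>, two
      points of \<open>S n\<close> have squared distance at most \<open>4 / Suc n\<close>; this
      explains the quarter.\<close>
    then obtain n where n: "inverse (real (Suc n)) < \<epsilon>\<^sup>2 / 4"
      using reals_Archimedean[of "\<epsilon>\<^sup>2 / 4"] by auto
    have "dist u v < \<epsilon>" if "u \<in> S n" "v \<in> S n" for u v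
    proof -
      have "(1/2) *\<^sub>R (u + v) \<in> L"
        using that by (intro csubspace_scaleR complex_vector.subspace_add L) (auto simp: S_def)
      from d[OF this] have "\<delta>\<^sup>2 \<le> (norm (y - (1/2) *\<^sub>R (u + v)))\<^sup>2"
        using \<open>\<delta> \<ge> 0\<close> by (simp add: power_mono)
      moreover have "(norm (u - v))\<^sup>2 = 2 * (norm (y - u))\<^sup>2 + 2 * (norm (y - v))\<^sup>2
          - 4 * (norm (y - (1/2) *\<^sub>R (u + v)))\<^sup>2"
        by (simp add: power2_norm_eq_inner inner_diff_left inner_diff_right inner_add_left
            inner_add_right inner_commute algebra_simps)
      moreover have "(norm (y - u))\<^sup>2 \<le> \<delta>\<^sup>2 + inverse (real (Suc n))"
          "(norm (y - v))\<^sup>2 \<le> \<delta>\<^sup>2 + inverse (real (Suc n))"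
        using that by (auto simp: S_def inverse_eq_divide)
      ultimately have "(norm (u - v))\<^sup>2 < \<epsilon>\<^sup>2"
        using n by linarith
      then show ?thesis
        using \<open>\<epsilon> > 0\<close> by (simp add: dist_norm power_less_imp_less_base)
    qed
    then show "\<exists>n. \<forall>x\<in>S n. \<forall>y\<in>S n. dist x y < \<epsilon>" by blast
  qed
  then obtain p where p: "\<And>n. p \<in> S n" by blast
  then have "p \<in> L" by (auto simp: S_def)
  have min: "(norm (y - p))\<^sup>2 \<le> \<delta>\<^sup>2"
  proof (rule field_le_epsilon)
    fix e :: real assume "e > 0"
    then obtain n where "inverse (real (Suc n)) < e"
      using reals_Archimedean by auto
    with p[of n] show "(norm (y - p))\<^sup>2 \<le> \<delta>\<^sup>2 + e"
      by (auto simp: S_def inverse_eq_divide)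
  qed
  have orth: "inner x (y - p) = 0" if "x \<in> L" for x
  proof (cases "x = 0")
    case False
    \<comment> \<open>This \<open>t\<close> minimises the distance from \<open>y\<close> to
      \<open>p + t x\<close>; a nonzero \<open>t\<close> would beat the minimal distance.\<close>
    define t where "t = inner x (y - p) / (norm x)\<^sup>2"
    have "p + t *\<^sub>R x \<in> L"
      by (intro complex_vector.subspace_add L \<open>p \<in> L\<close> csubspace_scaleR that)
    from d[OF this] have "\<delta>\<^sup>2 \<le> (norm (y - (p + t *\<^sub>R x)))\<^sup>2"
      using \<open>\<delta> \<ge> 0\<close> by (simp add: power_mono)
    also have "(norm (y - (p + t *\<^sub>R x)))\<^sup>2
        = (norm (y - p))\<^sup>2 - 2 * (t * inner x (y - p)) + t\<^sup>2 * (norm x)\<^sup>2"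
      unfolding power2_norm_eq_inner
      by (simp add: inner_diff_left inner_diff_right inner_add_left
            inner_add_right inner_commute algebra_simps power2_eq_square)
    also have "t\<^sup>2 * (norm x)\<^sup>2 = t * inner x (y - p)"
      using False by (simp add: t_def power2_eq_square)
    finally have "t * inner x (y - p) \<le> 0" using min by linarith
    moreover have "t * inner x (y - p) = (inner x (y - p))\<^sup>2 / (norm x)\<^sup>2"
      by (simp add: t_def power2_eq_square)
    ultimately have "(inner x (y - p))\<^sup>2 \<le> 0"
      using False by (simp add: divide_le_0_iff)
    then show ?thesis by simp
  qed simp
  show thesis
  proof
    show "y - p \<noteq> 0" using y \<open>p \<in> L\<close> by auto
    show "cinner x (y - p) = 0" if "x \<in> L" for x
    proof -
      \<comment> \<open>Real orthogonality to \<open>x\<close> kills the real part of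
        \<open>cinner\<close>; orthogonality to \<open>\<i> x\<close>, also in \<open>L\<close>,
        kills the imaginary part.\<close>
      have "inner (scaleC \<i> x) (y - p) = 0"
        using that by (intro orth complex_vector.subspace_scale L)
      with orth[OF that] show ?thesis
        by (simp add: inner_eq_Re_cinner cinner_scaleC_left complex_eq_iff)
    qed
  qed
qed

lemma csubspace_perp: "csubspace {x. cinner x h = 0}"
  by (rule complex_vector.subspaceI) (auto simp: cinner_add_left cinner_scaleC_left)

lemma closed_perp: "closed {x. cinner x h = 0}"
  by (intro closed_Collect_eq continuous_intros)

text \<open>Turns density into triviality of the orthogonal complement, the form in which CNC can be
  compared with spans.\<close>

lemma closed_cspan_eq_UNIV_iff:
  fixes S :: "'a::{complex_inner, complete_space} set"
  shows "closed_cspan S = UNIV \<longleftrightarrow> (\<forall>h. (\<forall>x\<in>S. cinner x h = 0) \<longrightarrow> h = 0)"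
proof (intro iffI allI impI)
  fix h assume "closed_cspan S = UNIV" "\<forall>x\<in>S. cinner x h = 0"
  then have "UNIV \<subseteq> {x. cinner x h = 0}"
    using closed_cspan_minimal[OF _ csubspace_perp closed_perp, of S h] by auto
  then show "h = 0"
    using cinner_self_eq_0_iff by blast
next
  assume *: "\<forall>h. (\<forall>x\<in>S. cinner x h = 0) \<longrightarrow> h = 0"
  show "closed_cspan S = UNIV"
  proof (rule ccontr)
    assume "closed_cspan S \<noteq> UNIV"
    then obtain h where "h \<noteq> 0" "\<And>x. x \<in> closed_cspan S \<Longrightarrow> cinner x h = 0"
      using closed_csubspace_perp_exists csubspace_closed_cspan closed_closed_cspan by metis
    with * show False
      using closed_cspan_superset by blast
  qed
qed

section \<open>Riesz representation and adjoints\<close>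

lemma clinear_iff:
  "clinear f \<longleftrightarrow> (\<forall>x y. f (x + y) = f x + f y) \<and> (\<forall>c x. f (scaleC c x) = scaleC c (f x))"
  by (simp add: clinear_def Vector_Spaces.linear_iff complex_vector.vector_space_axioms)

lemma clinear_imp_linear: "clinear f \<Longrightarrow> linear f"
  by (simp add: clinear_iff Real_Vector_Spaces.linear_iff flip: scaleC_of_real)

lemma riesz_representation:
  fixes f :: "'a::{complex_inner, complete_space} \<Rightarrow> complex"
  assumes "clinear f" "continuous_on UNIV f"
  obtains y where "\<And>x. f x = cinner x y"
proof (cases "\<forall>x. f x = 0")
  case True
  then show ?thesis using that[of 0] by simp
next
  case False
  have f: "f (x + y) = f x + f y" "f (scaleC c x) = c * f x" for x y c
    using assms(1) by (auto simp: clinear_iff scaleC_complex_def)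
  define K where "K = {x. f x = 0}"
  have f0: "f 0 = 0" using f(1)[of 0 0] by simp
  have fd: "f (x - y) = f x - f y" for x y
    using f(1)[of "x - y" y] by simp
  have "csubspace K"
    by (rule complex_vector.subspaceI) (auto simp: K_def f f0)
  moreover have "closed K"
    unfolding K_def by (intro closed_Collect_eq assms continuous_intros)
  moreover have "K \<noteq> UNIV" using False by (auto simp: K_def)
  ultimately obtain h where h: "h \<noteq> 0" "\<And>x. x \<in> K \<Longrightarrow> cinner x h = 0"
    using closed_csubspace_perp_exists by blast
  \<comment> \<open>Otherwise \<open>h\<close> would lie in the kernel \<open>K\<close> and be
    orthogonal to itself.\<close>
  have "f h \<noteq> 0"
    using h(1) h(2)[of h] by (auto simp: K_def)
  show ?thesis
  proof (rule that[of "scaleC (cnj (f h / cinner h h)) h"])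
    fix x
    have "x - scaleC (f x / f h) h \<in> K"
      using \<open>f h \<noteq> 0\<close> by (simp add: K_def fd f)
    from h(2)[OF this] have "cinner x h = f x / f h * cinner h h"
      by (simp add: cinner_diff_left cinner_scaleC_left)
    then show "f x = cinner x (scaleC (cnj (f h / cinner h h)) h)"
      using h(1) \<open>f h \<noteq> 0\<close> by (simp add: cinner_scaleC_right)
  qed
qed

text \<open>Identifies the choice made in \<open>cadjoint\<close>: some adjoint exists, and an
  adjoint is unique because inner products with all vectors determine a vector.\<close>

lemma cadjointI:
  assumes "\<And>x y. cinner (f x) y = cinner x (g y)"
  shows "cadjoint f = g"
proof -
  have "\<exists>g. \<forall>x y. cinner (f x) y = cinner x (g y)"
    using assms by blast
  from someI_ex[OF this] have *: "cinner (f x) y = cinner x (cadjoint f y)" for x y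
    unfolding cadjoint_def by blast
  show ?thesis
    by (rule ext, rule cinner_left_eqI) (simp only: assms flip: *)
qed

lemma cinner_cadjoint:
  fixes f :: "'a::{complex_inner, complete_space} \<Rightarrow> 'b::complex_inner"
  assumes "clinear f" "bounded_linear f"
  shows "cinner (f x) y = cinner x (cadjoint f y)"
proof -
  have "\<exists>z. \<forall>x. cinner (f x) y = cinner x z" for y
  proof -
    have "clinear (\<lambda>x. cinner (f x) y)"
      using assms(1) by (simp add: clinear_iff cinner_add_left cinner_scaleC_left scaleC_complex_def)
    moreover have "continuous_on UNIV (\<lambda>x. cinner (f x) y)"
      by (intro continuous_intros linear_continuous_on assms)
    ultimately show ?thesis
      using riesz_representation by metis
  qed
  then obtain g where "\<And>x y. cinner (f x) y = cinner x (g y)" by metis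
  with cadjointI[of f g] show ?thesis by simp
qed


section \<open>Square roots of positive operators\<close>

text \<open>Polarisation: realness of the quadratic form at \<open>x + y\<close> and at
  \<open>x + \<i> y\<close> gives the imaginary and the real part of the identity,
  respectively.\<close>

lemma positive_op_selfadjoint:
  assumes "positive_op A"
  shows "cinner (A x) y = cinner x (A y)"
proof -
  have A: "A (x + y) = A x + A y" "A (scaleC c x) = scaleC c (A x)" for x y c
    using assms unfolding positive_op_def clinear_iff by blast+
  have im: "Im (cinner (A x) x) = 0" for x
    using assms unfolding positive_op_def complex_is_Real_iff by blast
  have "Im (cinner (A x) y + cinner (A y) x) = 0"
    using im[of "x + y"] im[of x] im[of y] by (simp add: A cinner_add_left cinner_add_right)
  moreover have "Re (cinner (A x) y) = Re (cinner (A y) x)"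
    using im[of "x + scaleC \<i> y"] im[of x] im[of y]
    by (simp add: A cinner_add_left cinner_add_right cinner_scaleC_left cinner_scaleC_right)
  ultimately have "cinner (A x) y = cnj (cinner (A y) x)"
    by (simp add: complex_eq_iff)
  then show ?thesis by (simp flip: cinner_commute)
qed

text \<open>A fixed point \<open>Y = (B + Y^2) / 2\<close> satisfies
  \<open>(I - Y)^2 = I - B\<close>, so the limit of this iteration yields a square root of
  \<open>I - B\<close> without spectral theory.\<close>

primrec sqrt_iter :: "('a \<Rightarrow> 'a) \<Rightarrow> nat \<Rightarrow> 'a \<Rightarrow> 'a::real_vector"
  where "sqrt_iter B 0 = (\<lambda>x. 0)"
  | "sqrt_iter B (Suc n) = (\<lambda>x. (1/2) *\<^sub>R (B x + sqrt_iter B n (sqrt_iter B n x)))"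

text \<open>The same recursion for the scalar \<open>B = 1\<close>. It is increasing and bounded by
  1, and controls the norms of the iterates and of their increments.\<close>

primrec sqrt_majorant :: "nat \<Rightarrow> real"
  where "sqrt_majorant 0 = 0"
  | "sqrt_majorant (Suc n) = (1 + (sqrt_majorant n)\<^sup>2) / 2"

lemma sqrt_majorant_bounds: "0 \<le> sqrt_majorant n \<and> sqrt_majorant n \<le> 1"
  by (induction n) (auto simp: power_le_one)

lemma sqrt_majorant_mono: "mono sqrt_majorant"
proof (rule incseq_SucI)
  fix n
  show "sqrt_majorant n \<le> sqrt_majorant (Suc n)"
    using sum_squares_bound[of "sqrt_majorant n" 1] by simp
qed

lemma clinear_sqrt_iter: "clinear B \<Longrightarrow> clinear (sqrt_iter B n)"
proof (induction n)
  case (Suc n)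
  have "(1/2) *\<^sub>R scaleC c x = scaleC c ((1/2) *\<^sub>R x)" for c and x :: 'a
    by (simp add: scaleC_scaleC mult.commute flip: scaleC_of_real)
  with Suc show ?case
    by (simp add: clinear_iff scaleC_add_right scaleR_add_right)
qed (simp add: clinear_iff)

text \<open>The iterates are polynomials in \<open>B\<close>, so they commute with whatever commutes
  with \<open>B\<close>. Taking first \<open>C = B\<close> and then an iterate for \<open>C\<close>
  makes the iterates commute with each other.\<close>

lemma sqrt_iter_commute:
  assumes "linear C" "linear B" "\<And>x. C (B x) = B (C x)"
  shows "C (sqrt_iter B n x) = sqrt_iter B n (C x)"
  by (induction n arbitrary: x) (simp_all add: linear_0 linear_scale linear_add assms)

lemma sqrt_iter_commute_iter:
  assumes "linear B"
  assumes "\<And>n. linear (sqrt_iter B n)"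
  shows "sqrt_iter B m (sqrt_iter B n x) = sqrt_iter B n (sqrt_iter B m x)"
  using assms by (metis sqrt_iter_commute)

lemma sqrt_iter_selfadjoint:
  assumes "\<And>x y. cinner (B x) y = cinner x (B y)"
  shows "cinner (sqrt_iter B n x) y = cinner x (sqrt_iter B n y)"
proof (induction n arbitrary: x y)
  case (Suc n)
  show ?case
    by (simp add: cinner_add_left cinner_add_right cinner_scaleC_left cinner_scaleC_right
        assms Suc flip: scaleC_of_real)
qed simp

lemma norm_sqrt_iter:
  assumes "\<And>x. norm (B x) \<le> norm x"
  shows "norm (sqrt_iter B n x) \<le> sqrt_majorant n * norm x"
proof (induction n arbitrary: x)
  case (Suc n)
  have "norm (sqrt_iter B n (sqrt_iter B n x)) \<le> sqrt_majorant n * norm (sqrt_iter B n x)"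
    by (rule Suc)
  also have "\<dots> \<le> sqrt_majorant n * (sqrt_majorant n * norm x)"
    by (intro mult_left_mono Suc) (simp add: sqrt_majorant_bounds)
  finally have "norm (B x + sqrt_iter B n (sqrt_iter B n x))
      \<le> norm x + sqrt_majorant n * (sqrt_majorant n * norm x)"
    using assms[of x] by (intro norm_triangle_le) simp
  then show ?case by (simp add: power2_eq_square algebra_simps del: scaleR_add_right scaleR_right_distrib)
qed simp

text \<open>As everything commutes, \<open>Y\<^sup>2 - Y'\<^sup>2 = (Y - Y')(Y + Y')\<close>, so that the increments of the iteration
  are dominated by those of the scalar iteration for \<open>B = 1\<close>.\<close>

lemma norm_sqrt_iter_Suc_diff:
  assumes B: "clinear B" "\<And>x. norm (B x) \<le> norm x"
  shows "norm (sqrt_iter B (Suc n) x - sqrt_iter B n x)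
    \<le> (sqrt_majorant (Suc n) - sqrt_majorant n) * norm x"
proof (induction n arbitrary: x)
  case 0
  show ?case using B(2)[of x] by simp
next
  case (Suc n)
  let ?Y = "sqrt_iter B n" and ?Z = "sqrt_iter B (Suc n)"
  let ?y = "sqrt_majorant n" and ?z = "sqrt_majorant (Suc n)"
  have lin: "linear (sqrt_iter B m)" for m
    by (intro clinear_imp_linear clinear_sqrt_iter B)
  have "sqrt_iter B (Suc (Suc n)) x - ?Z x = (1/2) *\<^sub>R (?Z (?Z x) - ?Y (?Y x))"
    by (simp only: sqrt_iter.simps(2)[of B "Suc n"] sqrt_iter.simps(2)[of B n])
       (simp add: algebra_simps)
  also have "?Z (?Z x) - ?Y (?Y x) = ?Z (?Z x + ?Y x) - ?Y (?Z x + ?Y x)"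
    using sqrt_iter_commute_iter[OF clinear_imp_linear[OF B(1)] lin, of "Suc n" n x]
    by (simp only: linear_add[OF lin]) simp
  finally have "norm (sqrt_iter B (Suc (Suc n)) x - ?Z x)
      = norm (?Z (?Z x + ?Y x) - ?Y (?Z x + ?Y x)) / 2"
    by simp
  also have "\<dots> \<le> ((?z - ?y) * norm (?Z x + ?Y x)) / 2"
    by (intro divide_right_mono Suc) simp
  also have "\<dots> \<le> ((?z - ?y) * (?z * norm x + ?y * norm x)) / 2"
    using sqrt_majorant_mono[THEN monoD, of n "Suc n"]
    by (intro divide_right_mono mult_left_mono norm_triangle_le add_mono norm_sqrt_iter B)
       (simp_all del: sqrt_majorant.simps sqrt_iter.simps)
  also have "\<dots> = (sqrt_majorant (Suc (Suc n)) - ?z) * norm x"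
    by (simp only: sqrt_majorant.simps(2)[of "Suc n"] sqrt_majorant.simps(2)[of n])
       (simp add: power2_eq_square field_simps)
  finally show ?case .
qed

lemma norm_sqrt_iter_diff:
  assumes B: "clinear B" "\<And>x. norm (B x) \<le> norm x"
  shows "norm (sqrt_iter B (n + k) x - sqrt_iter B n x)
    \<le> (sqrt_majorant (n + k) - sqrt_majorant n) * norm x"
proof (induction k)
  case (Suc k)
  have "norm (sqrt_iter B (n + Suc k) x - sqrt_iter B n x)
      \<le> norm (sqrt_iter B (Suc (n + k)) x - sqrt_iter B (n + k) x)
        + norm (sqrt_iter B (n + k) x - sqrt_iter B n x)"
    using norm_triangle_ineq[of "sqrt_iter B (Suc (n + k)) x - sqrt_iter B (n + k) x"
        "sqrt_iter B (n + k) x - sqrt_iter B n x"] by simp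
  also have "\<dots> \<le> (sqrt_majorant (Suc (n + k)) - sqrt_majorant (n + k)) * norm x
      + (sqrt_majorant (n + k) - sqrt_majorant n) * norm x"
    by (intro add_mono Suc norm_sqrt_iter_Suc_diff B)
  finally show ?case by (simp add: algebra_simps)
qed simp

text \<open>The bounded monotone majorant converges, and its Cauchy estimate carries over to the
  iterates at each vector.\<close>

lemma convergent_sqrt_iter:
  fixes B :: "'h::{complex_inner, complete_space} \<Rightarrow> 'h"
  assumes B: "clinear B" "\<And>x. norm (B x) \<le> norm x"
  shows "convergent (\<lambda>n. sqrt_iter B n x)"
proof -
  have "Bseq sqrt_majorant"
    using sqrt_majorant_bounds by (intro BseqI'[of _ 1]) simp
  then have "convergent sqrt_majorant"
    using sqrt_majorant_mono by (intro Bseq_mono_convergent) (auto dest: monoD)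
  then have "Cauchy (\<lambda>n. sqrt_majorant n * norm x)"
    by (intro convergent_Cauchy convergent_mult convergent_const)
  then have "Cauchy (\<lambda>n. sqrt_iter B n x)"
    unfolding Cauchy_altdef2
  proof (intro allI impI)
    fix e :: real assume *: "e > 0"
       "\<forall>e>0. \<exists>N. \<forall>n\<ge>N. dist (sqrt_majorant n * norm x) (sqrt_majorant N * norm x) < e"
    then obtain N where N: "\<And>n. n \<ge> N \<Longrightarrow> dist (sqrt_majorant n * norm x) (sqrt_majorant N * norm x) < e"
      by blast
    have "dist (sqrt_iter B n x) (sqrt_iter B N x) < e" if "n \<ge> N" for n
      using norm_sqrt_iter_diff[OF B, of N "n - N" x] N[OF that] that
      by (simp add: dist_norm algebra_simps)
    then show "\<exists>N. \<forall>n\<ge>N. dist (sqrt_iter B n x) (sqrt_iter B N x) < e" by blast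
  qed
  then show ?thesis
    by (simp add: Cauchy_convergent_iff)
qed

text \<open>The root is \<open>S = I - Y\<close> with \<open>Y\<close> the pointwise limit of the
  iterates; it is positive since \<open>Y\<close> is a self-adjoint contraction.\<close>

lemma positive_sqrt_exists:
  fixes B :: "'h::{complex_inner, complete_space} \<Rightarrow> 'h"
  assumes B: "clinear B" "\<And>x. norm (B x) \<le> norm x"
    and sa: "\<And>x y. cinner (B x) y = cinner x (B y)"
  shows "\<exists>S. positive_op S \<and> S \<circ> S = (\<lambda>x. x - B x)"
proof -
  define Y where "Y x = lim (\<lambda>n. sqrt_iter B n x)" for x
  have Y: "(\<lambda>n. sqrt_iter B n x) \<longlonglongrightarrow> Y x" for x
    unfolding Y_def using convergent_sqrt_iter[OF B] by (simp add: convergent_LIMSEQ_iff)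
  have lin: "clinear (sqrt_iter B n)" for n
    by (intro clinear_sqrt_iter B)
  have norm_iter: "norm (sqrt_iter B n x) \<le> norm x" for n x
    using norm_sqrt_iter[of B n x, OF B(2)] sqrt_majorant_bounds[of n]
    by (meson mult_left_le_one_le norm_ge_zero order_trans)
  have norm_Y: "norm (Y x) \<le> norm x" for x
    using norm_iter by (intro tendsto_upperbound[OF tendsto_norm[OF Y]]) auto
  have linY: "clinear Y"
    unfolding clinear_iff
  proof (intro conjI allI)
    fix x y c
    have "(\<lambda>n. sqrt_iter B n x + sqrt_iter B n y) \<longlonglongrightarrow> Y x + Y y"
      by (intro tendsto_add Y)
    then show "Y (x + y) = Y x + Y y"
      using LIMSEQ_unique Y[of "x + y"] lin by (simp add: clinear_iff)
    have "(\<lambda>n. scaleC c (sqrt_iter B n x)) \<longlonglongrightarrow> scaleC c (Y x)"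
      by (intro bounded_linear.tendsto[OF bounded_linear_scaleC] Y)
    then show "Y (scaleC c x) = scaleC c (Y x)"
      using LIMSEQ_unique Y[of "scaleC c x"] lin by (simp add: clinear_iff)
  qed
  \<comment> \<open>Both factors vary with \<open>n\<close>, so pointwise convergence alone does not
    suffice; the iterates being contractions makes the error from the inner factor vanish.\<close>
  have YY: "(\<lambda>n. sqrt_iter B n (sqrt_iter B n x)) \<longlonglongrightarrow> Y (Y x)" for x
  proof -
    have "(\<lambda>n. sqrt_iter B n (sqrt_iter B n x - Y x)) \<longlonglongrightarrow> 0"
    proof (rule Lim_null_comparison)
      show "\<forall>\<^sub>F n in sequentially. norm (sqrt_iter B n (sqrt_iter B n x - Y x))
          \<le> norm (sqrt_iter B n x - Y x)"
        using norm_iter by simp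
      show "(\<lambda>n. norm (sqrt_iter B n x - Y x)) \<longlonglongrightarrow> 0"
        using Y[of x] by (simp add: LIM_zero tendsto_norm_zero)
    qed
    from tendsto_add[OF this Y[of "Y x"]] show ?thesis
      by (simp add: linear_diff[OF clinear_imp_linear[OF lin]])
  qed
  have Y_eq: "Y x = (1/2) *\<^sub>R (B x + Y (Y x))" for x
  proof (rule LIMSEQ_unique)
    show "(\<lambda>n. sqrt_iter B (Suc n) x) \<longlonglongrightarrow> Y x"
      using Y by (rule LIMSEQ_Suc)
    show "(\<lambda>n. sqrt_iter B (Suc n) x) \<longlonglongrightarrow> (1/2) *\<^sub>R (B x + Y (Y x))"
      unfolding sqrt_iter.simps by (intro tendsto_intros YY)
  qed
  have cont: "isCont (\<lambda>v. cinner v w) z" "isCont (\<lambda>v. cinner w v) z" for w z :: 'h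
    by (rule continuous_on_interior[of UNIV], intro continuous_intros, simp)+
  have Y_sa: "cinner (Y x) y = cinner x (Y y)" for x y
  proof (rule LIMSEQ_unique)
    show "(\<lambda>n. cinner (sqrt_iter B n x) y) \<longlonglongrightarrow> cinner (Y x) y"
      by (rule isCont_tendsto_compose[OF cont(1) Y])
    show "(\<lambda>n. cinner (sqrt_iter B n x) y) \<longlonglongrightarrow> cinner x (Y y)"
      unfolding sqrt_iter_selfadjoint[OF sa] by (rule isCont_tendsto_compose[OF cont(2) Y])
  qed
  define S where "S x = x - Y x" for x
  have "clinear S"
    using linY by (auto simp: clinear_iff S_def complex_vector.scale_right_diff_distrib)
  moreover have "bounded_linear S"
  proof (rule bounded_linear_intro[where K = 2])
    fix x y r
    show "S (x + y) = S x + S y" "S (r *\<^sub>R x) = r *\<^sub>R S x"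
      using clinear_imp_linear[OF \<open>clinear S\<close>] by (simp_all add: linear_add linear_scale)
    show "norm (S x) \<le> norm x * 2"
      using norm_triangle_ineq4[of x "Y x"] norm_Y[of x] by (simp add: S_def)
  qed
  moreover have "cinner (S x) x \<in> \<real> \<and> 0 \<le> Re (cinner (S x) x)" for x
  proof
    have "cinner (S x) x = cnj (cinner (S x) x)"
      by (metis S_def Y_sa cinner_commute cinner_diff_left cinner_diff_right)
    then show "cinner (S x) x \<in> \<real>"
      by (metis Reals_cnj_iff)
    have "inner (Y x) x \<le> norm x * norm x"
      using norm_cauchy_schwarz[of "Y x" x] norm_Y[of x]
      by (meson mult_right_mono norm_ge_zero order_trans)
    then show "0 \<le> Re (cinner (S x) x)"
      by (simp add: S_def inner_diff_left norm_eq_square dot_square_norm power2_eq_square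
          flip: inner_eq_Re_cinner)
  qed
  moreover have "S \<circ> S = (\<lambda>x. x - B x)"
  proof
    fix x
    have "2 *\<^sub>R Y x = B x + Y (Y x)"
      by (subst Y_eq) simp
    then show "(S \<circ> S) x = x - B x"
      by (simp add: S_def linear_diff[OF clinear_imp_linear[OF linY]] scaleR_2 algebra_simps)
  qed
  ultimately show ?thesis
    unfolding positive_op_def by blast
qed


section \<open>The defect operator of a row contraction\<close>

lemma row_op_axis:
  assumes "\<And>j. clinear (T j)"
  shows "row_op T (axis i x) = T i x"
proof -
  have "row_op T (axis i x) = (\<Sum>j\<in>UNIV. if j = i then T i x else 0)"
    unfolding row_op_def axis_def
    using linear_0[OF clinear_imp_linear[OF assms]] by (intro sum.cong) auto
  then show ?thesis by simp
qed

lemma norm_axis: "norm (axis i x) = norm (x :: 'a::real_normed_vector)"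
proof -
  have "norm (axis i x) = sqrt (\<Sum>j\<in>UNIV. if j = i then (norm x)\<^sup>2 else 0)"
    unfolding norm_vec_def L2_set_def axis_def
    by (intro arg_cong[where f = sqrt] sum.cong) auto
  then show ?thesis by simp
qed

lemma row_contraction_clinear: "row_contraction T \<Longrightarrow> clinear (T j)"
  by (simp add: row_contraction_def)

lemma row_contraction_linear: "row_contraction T \<Longrightarrow> linear (T j)"
  by (simp add: row_contraction_clinear clinear_imp_linear)

lemma row_contraction_norm_row_op: "row_contraction T \<Longrightarrow> norm (row_op T v) \<le> norm v"
  by (simp add: row_contraction_def)

lemma row_contraction_norm:
  assumes "row_contraction T"
  shows "norm (T j x) \<le> norm x"
  using row_contraction_norm_row_op[OF assms, of "axis j x"]
  by (simp add: row_op_axis[OF row_contraction_clinear[OF assms]] norm_axis)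

lemma row_contraction_bounded_linear: "row_contraction T \<Longrightarrow> bounded_linear (T j)"
  by (rule bounded_linear_intro[where K = 1])
    (simp_all add: linear_add[OF row_contraction_linear] linear_scale[OF row_contraction_linear]
      row_contraction_norm)

lemma cinner_cadjoint_row:
  fixes T :: "'d::finite \<Rightarrow> 'h::{complex_inner, complete_space} \<Rightarrow> 'h"
  assumes "row_contraction T"
  shows "cinner (T j x) y = cinner x (cadjoint (T j) y)"
  by (rule cinner_cadjoint[OF row_contraction_clinear row_contraction_bounded_linear]) fact+

lemma cadjoint_row_op:
  fixes T :: "'d::finite \<Rightarrow> 'h::{complex_inner, complete_space} \<Rightarrow> 'h"
  assumes "row_contraction T"
  shows "cadjoint (row_op T) h = (\<chi> j. cadjoint (T j) h)"
proof -
  have "cadjoint (row_op T) = (\<lambda>h. \<chi> j. cadjoint (T j) h)"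
    by (rule cadjointI)
      (simp add: row_op_def cinner_sum_left cinner_vec_def cinner_cadjoint_row[OF assms])
  then show ?thesis by simp
qed

lemma cinner_row_op:
  fixes T :: "'d::finite \<Rightarrow> 'h::{complex_inner, complete_space} \<Rightarrow> 'h"
  assumes "row_contraction T"
  shows "cinner (row_op T v) h = cinner v (cadjoint (row_op T) h)"
  by (simp add: cadjoint_row_op[OF assms] row_op_def cinner_sum_left cinner_vec_def
      cinner_cadjoint_row[OF assms])

lemma clinear_row_op: "(\<And>j. clinear (T j)) \<Longrightarrow> clinear (row_op T)"
  by (simp add: clinear_iff row_op_def sum.distrib scaleC_vec_def complex_vector.scale_sum_right)

lemma clinear_adjoint:
  assumes "\<And>x y. cinner (f x) y = cinner x (g y)"
  shows "clinear g"
  unfolding clinear_iff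
  by (intro conjI allI; rule cinner_left_eqI)
    (simp_all add: cinner_add_right cinner_scaleC_right flip: assms)

text \<open>Cauchy-Schwarz applied to \<open>(norm v)^2 = inner (row_op T v) h\<close>, where
  \<open>v\<close> is the image of \<open>h\<close> under the adjoint.\<close>

lemma norm_cadjoint_row_op_le:
  fixes T :: "'d::finite \<Rightarrow> 'h::{complex_inner, complete_space} \<Rightarrow> 'h"
  assumes "row_contraction T"
  shows "norm (cadjoint (row_op T) h) \<le> norm h"
proof -
  let ?v = "cadjoint (row_op T) h"
  have "(norm ?v)\<^sup>2 = inner (row_op T ?v) h"
    by (simp add: power2_norm_eq_inner inner_eq_Re_cinner cinner_row_op[OF assms])
  also have "\<dots> \<le> norm (row_op T ?v) * norm h"
    by (rule norm_cauchy_schwarz)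
  also have "\<dots> \<le> norm ?v * norm h"
    by (intro mult_right_mono row_contraction_norm_row_op assms) simp
  finally show ?thesis
    by (cases "?v = 0") (simp_all add: power2_eq_square)
qed

text \<open>The operator \<open>?B\<close> below is a self-adjoint contraction, so the square root
  chosen in \<open>defect_star\<close> exists.\<close>

lemma defect_star:
  fixes T :: "'d::finite \<Rightarrow> 'h::{complex_inner, complete_space} \<Rightarrow> 'h"
  assumes T: "row_contraction T"
  shows "positive_op (defect_star T)"
    and "defect_star T (defect_star T h) = h - row_op T (cadjoint (row_op T) h)"
proof -
  let ?B = "\<lambda>h. row_op T (cadjoint (row_op T) h)"
  have "clinear ?B"
    using clinear_row_op[of T] row_contraction_clinear[OF T]
      clinear_adjoint[OF cinner_row_op[OF T]]
    by (simp add: clinear_iff)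
  moreover have "norm (?B h) \<le> norm h" for h
    using row_contraction_norm_row_op[OF T] norm_cadjoint_row_op_le[OF T] order_trans by blast
  moreover have "cinner (?B x) y = cinner x (?B y)" for x y
    by (metis cinner_row_op[OF T] cinner_commute)
  ultimately have "\<exists>S. positive_op S \<and> S \<circ> S = (\<lambda>h. h - ?B h)"
    by (rule positive_sqrt_exists)
  from someI_ex[OF this] have *: "positive_op (defect_star T) \<and>
      defect_star T \<circ> defect_star T = (\<lambda>h. h - ?B h)"
    unfolding defect_star_def sqrt_op_def .
  then show "positive_op (defect_star T)" ..
  from * show "defect_star T (defect_star T h) = h - ?B h"
    by (metis comp_apply)
qed

lemma norm_defect_star:
  fixes T :: "'d::finite \<Rightarrow> 'h::{complex_inner, complete_space} \<Rightarrow> 'h"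
  assumes "row_contraction T"
  shows "(norm (defect_star T h))\<^sup>2 = (norm h)\<^sup>2 - (norm (cadjoint (row_op T) h))\<^sup>2"
proof -
  have "cinner (defect_star T h) (defect_star T h) = cinner (defect_star T (defect_star T h)) h"
    by (simp only: positive_op_selfadjoint[OF defect_star(1)[OF assms]])
  also have "\<dots> = cinner h h - cinner (cadjoint (row_op T) h) (cadjoint (row_op T) h)"
    by (simp only: defect_star(2)[OF assms] cinner_diff_left cinner_row_op[OF assms])
  finally have "complex_of_real ((norm (defect_star T h))\<^sup>2)
      = of_real ((norm h)\<^sup>2 - (norm (cadjoint (row_op T) h))\<^sup>2)"
    by (simp only: cinner_self of_real_diff)
  then show ?thesis by (simp only: of_real_eq_iff)
qed

text \<open>Translates the isometry condition in \<open>CNC\<close> into membership in the kernel of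
  the defect operator.\<close>

lemma norm_cadjoint_row_op_eq_iff:
  fixes T :: "'d::finite \<Rightarrow> 'h::{complex_inner, complete_space} \<Rightarrow> 'h"
  assumes "row_contraction T"
  shows "norm (cadjoint (row_op T) h) = norm h \<longleftrightarrow> defect_star T h = 0"
  using norm_defect_star[OF assms, of h]
  by (auto simp: power2_eq_iff_nonneg)

section \<open>Words in the row and the span criterion for CNC\<close>

lemma word_power_Nil [simp]: "word_power T [] = id"
  by (simp add: word_power_def)

lemma word_power_Cons [simp]: "word_power T (i # \<alpha>) = T i \<circ> word_power T \<alpha>"
  by (simp add: word_power_def)

lemma CNC_iff_words:
  fixes T :: "'d::finite \<Rightarrow> 'h::{complex_inner, complete_space} \<Rightarrow> 'h"
  assumes T: "row_contraction T"
  shows "CNC T \<longleftrightarrow> closed_cspan (\<Union>\<alpha>. word_power T \<alpha> ` range (defect_star T)) = UNIV"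
proof -
  let ?D = "defect_star T"
  \<comment> \<open>The orthogonal complement of the word span; it will turn out to be the largest
    subspace of the kind excluded by \<open>CNC\<close>.\<close>
  define N where "N = {h. \<forall>\<alpha> x. cinner (word_power T \<alpha> (?D x)) h = 0}"
  have sa: "cinner (?D x) y = cinner x (?D y)" for x y
    by (intro positive_op_selfadjoint defect_star(1) T)
  have N: "csubspace N" "cadjoint (T k) ` N \<subseteq> N" "\<forall>h\<in>N. norm (cadjoint (row_op T) h) = norm h" for k
  proof -
    show "csubspace N"
      by (rule complex_vector.subspaceI) (auto simp: N_def cinner_add_right cinner_scaleC_right)
    show "cadjoint (T k) ` N \<subseteq> N"
    proof
      fix g assume "g \<in> cadjoint (T k) ` N"
      then obtain h where h: "h \<in> N" "g = cadjoint (T k) h" by blast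
      \<comment> \<open>Taking the adjoint of \<open>T k\<close> prepends the letter
        \<open>k\<close> to the word, which gives co-invariance.\<close>
      have "cinner (word_power T \<alpha> (?D x)) g = cinner (word_power T (k # \<alpha>) (?D x)) h" for \<alpha> x
        by (simp add: h(2) cinner_cadjoint_row[OF T])
      with h(1) show "g \<in> N" by (simp add: N_def del: word_power_Cons)
    qed
    show "\<forall>h\<in>N. norm (cadjoint (row_op T) h) = norm h"
    proof
      fix h assume "h \<in> N"
      \<comment> \<open>The empty word with \<open>x = ?D h\<close> turns orthogonality into
        \<open>norm (?D h) = 0\<close>.\<close>
      then have "cinner (word_power T [] (?D (?D h))) h = 0"
        unfolding N_def by blast
      then have "cinner (?D h) (?D h) = 0"
        by (simp only: sa word_power_Nil id_apply)
      then show "norm (cadjoint (row_op T) h) = norm h"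
        by (simp add: norm_cadjoint_row_op_eq_iff[OF T])
    qed
  qed
  have max: "M \<subseteq> N" if M: "\<And>k. cadjoint (T k) ` M \<subseteq> M"
      "\<And>h. h \<in> M \<Longrightarrow> norm (cadjoint (row_op T) h) = norm h" for M
  proof
    fix h assume "h \<in> M"
    then have "cinner (word_power T \<alpha> (?D x)) h = 0" for \<alpha> x
    \<comment> \<open>The first letter of the word moves onto \<open>h\<close> as an adjoint, so
      \<open>h\<close> must range over all of \<open>M\<close>.\<close>
    proof (induction \<alpha> arbitrary: h)
      case Nil
      then show ?case
        using M(2)[of h] by (simp add: sa norm_cadjoint_row_op_eq_iff[OF T])
    next
      case (Cons k \<alpha>)
      then show ?case
        using M(1)[of k] by (auto simp: cinner_cadjoint_row[OF T])
    qed
    then show "h \<in> N" by (simp add: N_def)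
  qed
  have "CNC T \<longleftrightarrow> N = {0}"
    unfolding CNC_def
  proof (intro iffI notI)
    assume "\<not> (\<exists>M. csubspace M \<and> M \<noteq> {0} \<and> (\<forall>k. cadjoint (T k) ` M \<subseteq> M) \<and>
      (\<forall>h\<in>M. norm (cadjoint (row_op T) h) = norm h))"
    with N show "N = {0}" by blast
  next
    assume "N = {0}" and "\<exists>M. csubspace M \<and> M \<noteq> {0} \<and> (\<forall>k. cadjoint (T k) ` M \<subseteq> M) \<and>
      (\<forall>h\<in>M. norm (cadjoint (row_op T) h) = norm h)"
    then obtain M where M: "csubspace M" "M \<noteq> {0}" "\<And>k. cadjoint (T k) ` M \<subseteq> M"
      "\<And>h. h \<in> M \<Longrightarrow> norm (cadjoint (row_op T) h) = norm h"
      by blast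
    from max[OF M(3,4)] \<open>N = {0}\<close> M(2) complex_vector.subspace_0[OF M(1)]
    show False by blast
  qed
  also have "\<dots> \<longleftrightarrow> (\<forall>h. (\<forall>\<alpha> x. cinner (word_power T \<alpha> (?D x)) h = 0) \<longrightarrow> h = 0)"
    using complex_vector.subspace_0[OF N(1)] unfolding N_def by blast
  also have "\<dots> \<longleftrightarrow> closed_cspan (\<Union>\<alpha>. word_power T \<alpha> ` range ?D) = UNIV"
    unfolding closed_cspan_eq_UNIV_iff by (simp add: Ball_def) blast
  finally show ?thesis .
qed

lemma row_contraction_bounded_linear_word_power:
  "row_contraction T \<Longrightarrow> bounded_linear (word_power T \<alpha>)"
proof (induction \<alpha>)
  case Nil
  show ?case by (simp add: id_def bounded_linear_ident)
next
  case (Cons i \<alpha>)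
  then show ?case
    using bounded_linear_compose[OF row_contraction_bounded_linear] by (simp add: comp_def)
qed

text \<open>The preimage of the closed span under a bounded operator is a closed subspace, so it is
  enough that it contains \<open>S\<close>.\<close>

lemma clinear_image_closed_cspan_subset:
  assumes "clinear f" "bounded_linear f" "f ` S \<subseteq> closed_cspan S"
  shows "f ` closed_cspan S \<subseteq> closed_cspan S"
proof -
  have f: "f (x + y) = f x + f y" "f (scaleC c x) = scaleC c (f x)" for x y c
    using assms(1) unfolding clinear_iff by blast+
  note sub = csubspace_closed_cspan[of S]
  have "closed_cspan S \<subseteq> f -` closed_cspan S"
  proof (rule closed_cspan_minimal)
    show "csubspace (f -` closed_cspan S)"
      using complex_vector.subspace_0[OF sub] linear_0[OF clinear_imp_linear[OF assms(1)]]
      by (intro complex_vector.subspaceI)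
        (auto simp: f intro: complex_vector.subspace_add[OF sub] complex_vector.subspace_scale[OF sub])
    show "closed (f -` closed_cspan S)"
      using closed_closed_cspan linear_continuous_on[OF assms(2)]
      by (rule continuous_closed_vimage[OF _ continuous_on_interior[of UNIV]]) simp_all
  qed (use assms(3) in blast)
  then show ?thesis by blast
qed


section \<open>Resolvents\<close>

text \<open>\<open>row_eval T z h\<close> is the row applied to the column with entries
  \<open>cnj (z $ j)\<close> times \<open>h\<close>, whose norm is exactly
  \<open>norm z * norm h\<close>.\<close>

lemma norm_row_eval:
  assumes "row_contraction T"
  shows "norm (row_eval T z h) \<le> norm z * norm h"
proof -
  have "row_eval T z h = row_op T (\<chi> j. scaleC (cnj (z $ j)) h)"
    using row_contraction_clinear[OF assms] by (simp add: row_eval_def row_op_def clinear_iff)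
  also have "norm \<dots> \<le> norm (\<chi> j. scaleC (cnj (z $ j)) h)"
    by (rule row_contraction_norm_row_op[OF assms])
  also have "\<dots> = norm z * norm h"
    by (simp add: norm_vec_def norm_scaleC L2_set_left_distrib)
  finally show ?thesis .
qed

lemma clinear_row_eval:
  assumes "\<And>j. clinear (T j)"
  shows "clinear (row_eval T z)"
proof -
  have T: "T j (x + y) = T j x + T j y" "T j (scaleC c x) = scaleC c (T j x)" for j x y c
    using assms unfolding clinear_iff by blast+
  show ?thesis
    by (simp add: clinear_iff T row_eval_def scaleC_add_right sum.distrib
        complex_vector.scale_sum_right scaleC_scaleC mult.commute)
qed

lemma row_contraction_bounded_linear_row_eval:
  assumes "row_contraction T"
  shows "bounded_linear (row_eval T z)"
proof -
  have "linear (row_eval T z)"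
    by (intro clinear_imp_linear clinear_row_eval row_contraction_clinear assms)
  then show ?thesis
    by (intro bounded_linear_intro[where K = "norm z"])
      (simp_all add: linear_add linear_scale norm_row_eval[OF assms] mult.commute[of _ "norm z"])
qed

lemma inj_id_minus_contraction:
  assumes "linear A" "\<And>x. norm (A x) \<le> c * norm x" "c < 1"
  shows "inj (\<lambda>x. x - A x)"
proof (rule injI)
  fix x y assume "x - A x = y - A y"
  then have "A (x - y) = x - y"
    by (simp add: linear_diff[OF assms(1)] algebra_simps)
  then have "norm (x - y) \<le> c * norm (x - y)"
    using assms(2)[of "x - y"] by simp
  then have "(1 - c) * norm (x - y) \<le> 0"
    by (simp only: left_diff_distrib mult_1 diff_le_0_iff_le)
  then show "x = y"
    using \<open>c < 1\<close> by (simp add: mult_le_0_iff)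
qed

text \<open>The value of the inverse at \<open>y\<close> is the fixed point of the contraction
  \<open>x \<mapsto> y + A x\<close>. Running Banach's theorem inside \<open>L\<close> shows that it
  stays in \<open>L\<close>; \<open>L = UNIV\<close> gives the bare resolvent equation.\<close>

lemma inv_id_minus_contraction:
  fixes A :: "'a::{real_normed_vector, complete_space} \<Rightarrow> 'a"
  assumes A: "linear A" "\<And>x. norm (A x) \<le> c * norm x" and "0 \<le> c" "c < 1"
  assumes L: "closed L" "\<And>x y. x \<in> L \<Longrightarrow> y \<in> L \<Longrightarrow> x + y \<in> L" "A ` L \<subseteq> L" and "y \<in> L"
  shows "inv (\<lambda>x. x - A x) y \<in> L"
    and "inv (\<lambda>x. x - A x) y = y + A (inv (\<lambda>x. x - A x) y)"
proof -
  have "\<exists>!x\<in>L. y + A x = x"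
  proof (rule Banach_fix[OF _ _ \<open>0 \<le> c\<close> \<open>c < 1\<close>])
    show "complete L" using L(1) by (simp add: complete_eq_closed)
    show "L \<noteq> {}" using \<open>y \<in> L\<close> by blast
    show "(\<lambda>x. y + A x) ` L \<subseteq> L" using L(2,3) \<open>y \<in> L\<close> by blast
    show "dist (y + A u) (y + A v) \<le> c * dist u v" for u v
      using A(2)[of "u - v"] by (simp add: dist_norm linear_diff[OF A(1)])
  qed
  then obtain x where x: "x \<in> L" "y + A x = x" by blast
  have "inv (\<lambda>x. x - A x) y = x"
    using x(2) by (intro inv_f_eq inj_id_minus_contraction[OF A \<open>c < 1\<close>]) (simp add: algebra_simps)
  with x show "inv (\<lambda>x. x - A x) y \<in> L"
    and "inv (\<lambda>x. x - A x) y = y + A (inv (\<lambda>x. x - A x) y)"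
    by simp_all
qed

lemma resolvent_span_subset_word_span:
  fixes T :: "'d::finite \<Rightarrow> 'h::{complex_inner, complete_space} \<Rightarrow> 'h"
  assumes T: "row_contraction T"
  shows "closed_cspan (\<Union>z\<in>ball 0 1. inv (\<lambda>h. h - row_eval T z h) ` range (defect_star T))
    \<subseteq> closed_cspan (\<Union>\<alpha>. word_power T \<alpha> ` range (defect_star T))" (is "_ \<subseteq> closed_cspan ?W")
proof (rule closed_cspan_minimal[OF _ csubspace_closed_cspan closed_closed_cspan], safe)
  fix z :: "complex ^ 'd" and x
  assume "z \<in> ball 0 1"
  have sub: "csubspace (closed_cspan ?W)"
    by (rule csubspace_closed_cspan)
  have "T k ` ?W \<subseteq> ?W" for k
  proof safe
    fix \<alpha> y
    have "T k (word_power T \<alpha> (defect_star T y)) = word_power T (k # \<alpha>) (defect_star T y)"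
      by simp
    then show "T k (word_power T \<alpha> (defect_star T y)) \<in> ?W" by blast
  qed
  then have TW: "T k ` closed_cspan ?W \<subseteq> closed_cspan ?W" for k
    by (intro clinear_image_closed_cspan_subset row_contraction_clinear
        row_contraction_bounded_linear T order_trans[OF _ closed_cspan_superset])
  show "inv (\<lambda>h. h - row_eval T z h) (defect_star T x) \<in> closed_cspan ?W"
  proof (rule inv_id_minus_contraction(1))
    show "linear (row_eval T z)"
      by (intro clinear_imp_linear clinear_row_eval row_contraction_clinear T)
    show "row_eval T z ` closed_cspan ?W \<subseteq> closed_cspan ?W"
      unfolding row_eval_def using TW
      by (intro image_subsetI complex_vector.subspace_sum[OF sub]
          complex_vector.subspace_scale[OF sub]) blast
    \<comment> \<open>The empty word places the range of the defect operator in the span.\<close>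
    have "word_power T [] (defect_star T x) \<in> ?W" by blast
    then show "defect_star T x \<in> closed_cspan ?W"
      using closed_cspan_superset[of ?W] by (simp only: word_power_Nil id_apply) blast
    show "norm (row_eval T z h) \<le> norm z * norm h" for h
      by (rule norm_row_eval[OF T])
    show "norm z < 1" using \<open>z \<in> ball 0 1\<close> by simp
  qed (simp_all add: complex_vector.subspace_add[OF sub] closed_closed_cspan)
qed


section \<open>Commuting rows\<close>

lemma word_power_append: "word_power T (\<alpha> @ \<beta>) = word_power T \<alpha> \<circ> word_power T \<beta>"
  by (induction \<alpha>) auto

text \<open>A word power folds the commuting maps \<open>S \<mapsto> T i \<circ> S\<close>, so only
  the multiset of letters matters. The reversal appears because \<open>foldr\<close> is a
  \<open>fold\<close> over the reversed list.\<close>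

lemma word_power_cong_letter_count:
  assumes "\<And>i j. T i \<circ> T j = T j \<circ> T i" and "letter_count \<alpha> = letter_count \<beta>"
  shows "word_power T \<alpha> = word_power T \<beta>"
proof -
  have "count_list \<alpha> i = count_list \<beta> i" for i
    using assms(2) by (simp add: letter_count_def vec_eq_iff)
  then have "mset (rev \<alpha>) = mset (rev \<beta>)"
    by (simp add: multiset_eq_iff count_mset)
  moreover have "(\<lambda>S. T i \<circ> S) \<circ> (\<lambda>S. T j \<circ> S) = (\<lambda>S. T j \<circ> S) \<circ> (\<lambda>S. T i \<circ> S)" for i j
    using assms(1)[of i j] by (simp add: fun_eq_iff)
  ultimately show ?thesis
    unfolding word_power_def foldr_conv_fold by (metis fold_multiset_equiv)
qed

lemma multi_power_letter_count:
  assumes "\<And>i j. T i \<circ> T j = T j \<circ> T i"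
  shows "multi_power T (letter_count \<alpha>) h
    = real (card {\<beta>. letter_count \<beta> = letter_count \<alpha>}) *\<^sub>R word_power T \<alpha> h"
proof -
  have "multi_power T (letter_count \<alpha>) h
      = (\<Sum>\<beta> | letter_count \<beta> = letter_count \<alpha>. word_power T \<alpha> h)"
    unfolding multi_power_def
  proof (rule sum.cong)
    fix \<beta> assume "\<beta> \<in> {\<beta>. letter_count \<beta> = letter_count \<alpha>}"
    then have "word_power T \<beta> = word_power T \<alpha>"
      by (intro word_power_cong_letter_count assms) simp
    then show "word_power T \<beta> h = word_power T \<alpha> h" by simp
  qed simp
  then show ?thesis by (simp add: sum_constant_scaleR)
qed

text \<open>In the commuting case each \<open>multi_power\<close> is a positive multiple of any
  single word with these letter counts, so both families have the same span.\<close>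

lemma multi_span_eq_word_span:
  fixes T :: "'d::finite \<Rightarrow> 'h::complex_inner \<Rightarrow> 'h"
  assumes comm: "\<And>i j. T i \<circ> T j = T j \<circ> T i"
  shows "closed_cspan (\<Union>n. multi_power T n ` S) = closed_cspan (\<Union>\<alpha>. word_power T \<alpha> ` S)"
    (is "closed_cspan ?M = closed_cspan ?W")
proof (rule antisym; rule closed_cspan_minimal[OF _ csubspace_closed_cspan closed_closed_cspan]; safe)
  fix n x assume "x \<in> S"
  then have "word_power T \<alpha> x \<in> closed_cspan ?W" for \<alpha>
    using closed_cspan_superset[of ?W] by blast
  then show "multi_power T n x \<in> closed_cspan ?W"
    unfolding multi_power_def
    by (intro complex_vector.subspace_sum csubspace_closed_cspan)
next
  fix \<alpha> :: "'d list" and x assume "x \<in> S"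
  let ?c = "card {\<beta>. letter_count \<beta> = letter_count \<alpha>}"
  \<comment> \<open>The set is finite and contains \<alpha> itself, so division by its cardinality
    is legitimate.\<close>
  have "0 < ?c"
    using finite_letter_count[of "letter_count \<alpha>"] by (auto simp: card_gt_0_iff)
  then have "word_power T \<alpha> x = (1 / real ?c) *\<^sub>R multi_power T (letter_count \<alpha>) x"
    by (simp add: multi_power_letter_count[of T, OF comm])
  moreover have "multi_power T (letter_count \<alpha>) x \<in> closed_cspan ?M"
    using \<open>x \<in> S\<close> closed_cspan_superset[of ?M] by blast
  ultimately show "word_power T \<alpha> x \<in> closed_cspan ?M"
    by (simp only: csubspace_scaleR[OF csubspace_closed_cspan])
qed

section \<open>Recovering words from resolvents: Neumann coefficients and directional
  derivatives\<close>

lemma bounded_linear_funpow: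
  fixes A :: "'a::real_normed_vector \<Rightarrow> 'a"
  assumes "bounded_linear A"
  shows "bounded_linear (A ^^ k)"
proof (induction k)
  case (Suc k)
  have "A ^^ Suc k = (\<lambda>x. A ((A ^^ k) x))"
    by (simp add: fun_eq_iff)
  with bounded_linear_compose[OF assms Suc] show ?case
    by (simp only:)
qed (simp add: id_def bounded_linear_ident)

text \<open>A bootstrap from the equation alone: once \<open>t K \<le> 1/2\<close>, it forces
  \<open>norm (x t) \<le> 2 * norm y\<close>, and then \<open>x t - y\<close> is of order
  \<open>t\<close>.\<close>

lemma tendsto_neumann_resolvent:
  fixes A :: "'a::real_normed_vector \<Rightarrow> 'a"
  assumes "bounded_linear A"
    and "\<forall>\<^sub>F t in at_right 0. x t = y + t *\<^sub>R A (x t)"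
  shows "(x \<longlongrightarrow> y) (at_right 0)"
proof -
  obtain K where K: "K > 0" "\<And>v. norm (A v) \<le> norm v * K"
    using bounded_linear.pos_bounded[OF assms(1)] by blast
  have "\<forall>\<^sub>F t in at_right 0. t < 1 / (2 * K)"
    using K(1) by (intro order_tendstoD(2)[OF tendsto_ident_at]) simp
  then have "\<forall>\<^sub>F t in at_right 0. norm (x t - y) \<le> t * (2 * norm y * K)"
    using assms(2) eventually_at_right_less[of 0]
  proof eventually_elim
    case (elim t)
    have 1: "norm (x t - y) \<le> t * (norm (x t) * K)"
      using elim K(2)[of "x t"]
      by (metis abs_of_pos add_diff_cancel_left' mult_left_mono norm_scaleR order_less_imp_le)
    have "t * K \<le> 1 / 2"
      using elim K(1) by (simp add: field_simps)
    then have "t * (norm (x t) * K) \<le> norm (x t) * (1 / 2)"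
      using mult_left_mono[of "t * K" "1/2" "norm (x t)"] by (simp add: mult_ac)
    with 1 have "norm (x t) \<le> 2 * norm y"
      using norm_triangle_sub[of "x t" y] by simp
    then have "t * (norm (x t) * K) \<le> t * (2 * norm y * K)"
      using elim K(1) by (intro mult_left_mono mult_right_mono) auto
    with 1 show ?case by simp
  qed
  moreover have "((\<lambda>t. t * (2 * norm y * K)) \<longlongrightarrow> 0) (at_right 0)"
    by (rule tendsto_eq_intros refl)+ simp
  ultimately have "((\<lambda>t. x t - y) \<longlongrightarrow> 0) (at_right 0)"
    by (rule Lim_null_comparison)
  then show ?thesis by (simp add: LIM_zero_iff)
qed

text \<open>Extracts the coefficients \<open>A\<^sup>k y\<close> of the Neumann series \<open>x t = (I - t A)\<^sup>-\<^sup>1 y\<close> one at a time: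
  \<open>A\<^sup>k x t - A\<^sup>k y = t A\<^sup>k\<^sup>+\<^sup>1 x t\<close>.\<close>

lemma funpow_mem_of_neumann_resolvent:
  fixes A :: "'a::real_normed_vector \<Rightarrow> 'a"
  assumes A: "bounded_linear A" and L: "subspace L" "closed L"
    and x: "\<forall>\<^sub>F t in at_right 0. x t = y + t *\<^sub>R A (x t)" "\<forall>\<^sub>F t in at_right 0. x t \<in> L"
  shows "(A ^^ k) y \<in> L"
proof -
  \<comment> \<open>As \<open>t\<close> decreases to 0, \<open>x t\<close> tends to
    \<open>y\<close>; closedness of \<open>L\<close> passes membership to the limit.\<close>
  have lim: "(A ^^ k) y \<in> L" if "\<forall>\<^sub>F t in at_right 0. (A ^^ k) (x t) \<in> L" for k
    using that by (rule Lim_in_closed_set[OF L(2)])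
      (simp_all add: bounded_linear.tendsto[OF bounded_linear_funpow[OF A]]
        tendsto_neumann_resolvent[OF A x(1)])
  have "\<forall>\<^sub>F t in at_right 0. (A ^^ k) (x t) \<in> L"
  proof (induction k)
    case 0
    with x(2) show ?case by simp
  next
    case (Suc k)
    from Suc x(1) eventually_at_right_less[of 0] show ?case
    proof eventually_elim
      case (elim t)
      have "(A ^^ k) (x t) = (A ^^ k) (y + t *\<^sub>R A (x t))"
        using elim(2) by (rule arg_cong)
      also have "\<dots> = (A ^^ k) y + t *\<^sub>R (A ^^ Suc k) (x t)"
        using bounded_linear.linear[OF bounded_linear_funpow[OF A, of k]]
        by (simp add: linear_add linear_scale funpow_swap1)
      finally have "(A ^^ k) (x t) - (A ^^ k) y = t *\<^sub>R (A ^^ Suc k) (x t)"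
        by (simp only: add_diff_cancel_left')
      \<comment> \<open>The one-sided filter provides \<open>t > 0\<close>, so the factor
        \<open>t\<close> can be divided out.\<close>
      then have "(A ^^ Suc k) (x t) = inverse t *\<^sub>R ((A ^^ k) (x t) - (A ^^ k) y)"
        using elim(3) by (simp del: funpow.simps)
      also have "\<dots> \<in> L"
        by (intro subspace_scale subspace_diff L elim lim Suc)
      finally show ?case .
    qed
  qed
  then show ?thesis by (rule lim)
qed

text \<open>Product rule by induction on \<open>m\<close>; commutation moves every \<open>E\<close>
  to the front, so the \<open>m\<close> terms coincide.\<close>

lemma has_vector_derivative_funpow_add:
  fixes W E :: "'a::real_normed_vector \<Rightarrow> 'a"
  assumes W: "bounded_linear W" and E: "bounded_linear E" and comm: "\<And>x. W (E x) = E (W x)"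
  shows "((\<lambda>t. ((\<lambda>x. W x + t *\<^sub>R E x) ^^ m) h) has_vector_derivative
    real m *\<^sub>R E ((W ^^ (m - 1)) h)) (at 0)"
proof (induction m)
  case (Suc m)
  let ?f = "\<lambda>t. ((\<lambda>x. W x + t *\<^sub>R E x) ^^ m) h"
  have "((\<lambda>t. W (?f t) + t *\<^sub>R E (?f t)) has_vector_derivative
      W (real m *\<^sub>R E ((W ^^ (m - 1)) h))
        + (0 *\<^sub>R E (real m *\<^sub>R E ((W ^^ (m - 1)) h)) + 1 *\<^sub>R E (?f 0))) (at 0)"
    by (intro has_vector_derivative_add has_vector_derivative_scaleR DERIV_ident
        bounded_linear.has_vector_derivative[OF W] bounded_linear.has_vector_derivative[OF E] Suc)
  \<comment> \<open>The truncated exponent \<open>m - 1\<close> forces a case split: for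
    \<open>m = 0\<close> both sides vanish because of the factor \<open>real m\<close>.\<close>
  moreover have "W (real m *\<^sub>R E ((W ^^ (m - 1)) h)) = real m *\<^sub>R E ((W ^^ m) h)"
    by (cases m) (simp_all add: comm linear_0 linear_scale bounded_linear.linear[OF W])
  ultimately show ?case
    by (simp add: algebra_simps)
qed (simp add: has_vector_derivative_const)

text \<open>The derivative is a limit of difference quotients, all of which lie in
  \<open>L\<close>.\<close>

lemma has_vector_derivative_mem_closed_subspace:
  assumes f: "(f has_vector_derivative f') (at a)" and L: "subspace L" "closed L" "\<And>t. f t \<in> L"
  shows "f' \<in> L"
proof (rule Lim_in_closed_set[OF L(2)])
  have "((\<lambda>t. norm (f t - f a - (t - a) *\<^sub>R f') / norm (t - a)) \<longlongrightarrow> 0) (at a)"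
    using f by (simp add: has_vector_derivative_def has_derivative_iff_norm)
  moreover have "norm (f t - f a - (t - a) *\<^sub>R f') / norm (t - a)
      = norm ((f t - f a) /\<^sub>R (t - a) - f')" if "t \<noteq> a" for t
  proof -
    have "(f t - f a) /\<^sub>R (t - a) - f' = (f t - f a - (t - a) *\<^sub>R f') /\<^sub>R (t - a)"
      using that by (simp add: scaleR_diff_right)
    then show ?thesis by (simp add: divide_inverse abs_inverse)
  qed
  then have "\<forall>\<^sub>F t in at a. norm (f t - f a - (t - a) *\<^sub>R f') / norm (t - a)
      = norm ((f t - f a) /\<^sub>R (t - a) - f')"
    by (simp add: eventually_at_filter)
  ultimately have "((\<lambda>t. norm ((f t - f a) /\<^sub>R (t - a) - f')) \<longlongrightarrow> 0) (at a)"
    by (rule Lim_transform_eventually)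
  then show "((\<lambda>t. (f t - f a) /\<^sub>R (t - a)) \<longlongrightarrow> f') (at a)"
    by (simp add: tendsto_norm_zero_iff LIM_zero_iff)
qed (simp_all add: L subspace_diff subspace_scale)

lemma csubspace_imp_subspace: "csubspace L \<Longrightarrow> subspace L"
  by (simp add: subspace_def complex_vector.subspace_0 complex_vector.subspace_add csubspace_scaleR)

lemma scaleC_scaleR_left: "scaleC (r *\<^sub>R a) x = r *\<^sub>R scaleC a x"
  by (simp add: scaleR_conv_of_real flip: scaleC_scaleC scaleC_of_real)

lemma row_eval_scaleR: "row_eval T (t *\<^sub>R z) h = t *\<^sub>R row_eval T z h"
  by (simp add: row_eval_def scaleC_scaleR_left scaleR_sum_right)

lemma row_eval_add: "row_eval T (z + w) h = row_eval T z h + row_eval T w h"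
  by (simp add: row_eval_def scaleC_add_left sum.distrib)

lemma row_eval_axis: "row_eval T (axis i 1) h = T i h"
proof -
  have "row_eval T (axis i 1) h = (\<Sum>j\<in>UNIV. if j = i then T i h else 0)"
    unfolding row_eval_def axis_def by (intro sum.cong) auto
  then show ?thesis by simp
qed

text \<open>Differentiating a power of \<open>row_eval T z\<close> in direction
  \<open>axis i 1\<close> splits off one factor \<open>T i\<close>. Each letter of the word costs
  one derivative, so \<open>z\<close> and \<open>k\<close> must be arbitrary in the
  induction.\<close>

lemma word_power_row_eval_mem:
  fixes T :: "'d::finite \<Rightarrow> 'h::complex_inner \<Rightarrow> 'h"
  assumes T: "row_contraction T" and comm: "\<And>i j. T i \<circ> T j = T j \<circ> T i"
    and L: "subspace L" "closed L"
    and y: "\<And>z k. (row_eval T z ^^ k) y \<in> L"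
  shows "word_power T \<alpha> ((row_eval T z ^^ k) y) \<in> L"
\<comment> \<open>The word grows at its right end, because the split-off factor stands between
  \<open>word_power T \<alpha>\<close> and the remaining power.\<close>
proof (induction \<alpha> arbitrary: z k rule: rev_induct)
  case Nil
  show ?case using y by simp
next
  case (snoc i \<alpha>)
  have comm_i: "row_eval T z (T i x) = T i (row_eval T z x)" for x
  proof -
    have "T j (T i x) = T i (T j x)" for j
      using comm by (metis comp_apply)
    moreover have "T i (\<Sum>j\<in>UNIV. scaleC (cnj (z $ j)) (T j x))
        = (\<Sum>j\<in>UNIV. T i (scaleC (cnj (z $ j)) (T j x)))"
      by (rule linear_sum[OF row_contraction_linear[OF T]])
    ultimately show ?thesis
      using row_contraction_clinear[OF T, of i] by (simp add: row_eval_def clinear_iff)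
  qed
  \<comment> \<open>The exponent \<open>Suc k\<close> leaves the wanted power \<open>k\<close> after
    differentiation. The induction hypothesis puts \<open>?f t\<close> in \<open>L\<close> for every
    \<open>t\<close>.\<close>
  let ?f = "\<lambda>t. word_power T \<alpha> ((row_eval T (z + t *\<^sub>R axis i 1) ^^ Suc k) y)"
  have "(?f has_vector_derivative
      word_power T \<alpha> (real (Suc k) *\<^sub>R T i ((row_eval T z ^^ k) y))) (at 0)"
    using has_vector_derivative_funpow_add[OF row_contraction_bounded_linear_row_eval[OF T]
        row_contraction_bounded_linear[OF T] comm_i, where m = "Suc k" and h = y]
    unfolding row_eval_add[abs_def] row_eval_scaleR row_eval_axis diff_Suc_1
    by (intro bounded_linear.has_vector_derivative[OF
          row_contraction_bounded_linear_word_power[OF T]])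
  then have "word_power T \<alpha> (real (Suc k) *\<^sub>R T i ((row_eval T z ^^ k) y)) \<in> L"
    using L snoc by (rule has_vector_derivative_mem_closed_subspace)
  then have "real (Suc k) *\<^sub>R word_power T \<alpha> (T i ((row_eval T z ^^ k) y)) \<in> L"
    by (simp only: linear_scale[OF bounded_linear.linear[OF
            row_contraction_bounded_linear_word_power[OF T]]])
  from subspace_scale[OF L(1) this, of "inverse (real (Suc k))"] show ?case
    by (simp add: word_power_append del: of_nat_Suc)
qed

text \<open>For arbitrary \<open>z\<close>, the points \<open>t *\<^sub>R z\<close> lie in the ball
  for small \<open>t > 0\<close>, and the resolvents there yield all powers of
  \<open>row_eval T z\<close> at \<open>y\<close>; commutation then yields the words.\<close>

lemma word_span_subset_resolvent_span:
  fixes T :: "'d::finite \<Rightarrow> 'h::{complex_inner, complete_space} \<Rightarrow> 'h"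
  assumes T: "row_contraction T" and comm: "\<And>i j. T i \<circ> T j = T j \<circ> T i"
  shows "closed_cspan (\<Union>\<alpha>. word_power T \<alpha> ` S)
    \<subseteq> closed_cspan (\<Union>z\<in>ball 0 1. inv (\<lambda>h. h - row_eval T z h) ` S)" (is "_ \<subseteq> closed_cspan ?R")
proof (rule closed_cspan_minimal[OF _ csubspace_closed_cspan closed_closed_cspan], safe)
  fix \<alpha> y assume "y \<in> S"
  have L: "subspace (closed_cspan ?R)"
    by (intro csubspace_imp_subspace csubspace_closed_cspan)
  have "(row_eval T z ^^ k) y \<in> closed_cspan ?R" for z k
  proof -
    define x where "x t = inv (\<lambda>h. h - row_eval T (t *\<^sub>R z) h) y" for t
    have "((\<lambda>t. norm (t *\<^sub>R z)) \<longlongrightarrow> 0) (at_right 0)"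
      by (rule tendsto_eq_intros refl)+ simp
    then have ev: "\<forall>\<^sub>F t in at_right 0. norm (t *\<^sub>R z) < 1"
      by (rule order_tendstoD) simp
    show ?thesis
    proof (rule funpow_mem_of_neumann_resolvent[OF _ L closed_closed_cspan])
      show "bounded_linear (row_eval T z)"
        by (rule row_contraction_bounded_linear_row_eval[OF T])
      show "\<forall>\<^sub>F t in at_right 0. x t = y + t *\<^sub>R row_eval T z (x t)"
        using ev
      proof eventually_elim
        case (elim t)
        have "x t = y + row_eval T (t *\<^sub>R z) (x t)"
          unfolding x_def
          by (rule inv_id_minus_contraction(2)[where L = UNIV and c = "norm (t *\<^sub>R z)"])
            (simp_all add: elim[simplified] norm_row_eval[OF T, of "t *\<^sub>R z", simplified] bounded_linear.linear
              row_contraction_bounded_linear_row_eval[OF T])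
        then show ?case by (simp only: row_eval_scaleR)
      qed
      show "\<forall>\<^sub>F t in at_right 0. x t \<in> closed_cspan ?R"
        using ev
      proof eventually_elim
        case (elim t)
        then have "x t \<in> ?R"
          using \<open>y \<in> S\<close> unfolding x_def by (intro UN_I[of "t *\<^sub>R z"] imageI) simp_all
        then show ?case
          using closed_cspan_superset[of ?R] by blast
      qed
    qed
  qed
  \<comment> \<open>Power 0 leaves just the word applied to \<open>y\<close>; the point
    \<open>z = 0\<close> is an arbitrary choice.\<close>
  then have "word_power T \<alpha> ((row_eval T 0 ^^ 0) y) \<in> closed_cspan ?R"
    by (intro word_power_row_eval_mem T comm L closed_closed_cspan)
  then show "word_power T \<alpha> y \<in> closed_cspan ?R" by simp
qed

theorem corollary3p4:
  fixes T :: "'d::finite \<Rightarrow> 'h::{complex_inner, complete_space} \<Rightarrow> 'h"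
  assumes "separable_space (euclidean :: 'h topology)"
    and "row_contraction T"
  shows "(CNC T \<longleftrightarrow>
            UNIV = closed_cspan (\<Union>\<alpha>. word_power T \<alpha> ` range (defect_star T)))
       \<and> (d_contraction T \<longrightarrow>
            (CNC T \<longleftrightarrow>
               UNIV = closed_cspan (\<Union>n. multi_power T n ` range (defect_star T))
             \<and> closed_cspan (\<Union>n. multi_power T n ` range (defect_star T))
               = closed_cspan (\<Union>z\<in>ball 0 1. inv (\<lambda>h. h - row_eval T z h) ` range (defect_star T))))
       \<and> (UNIV = closed_cspan (\<Union>z\<in>ball 0 1. inv (\<lambda>h. h - row_eval T z h) ` range (defect_star T))
            \<longrightarrow> CNC T)"
proof -
  let ?W = "closed_cspan (\<Union>\<alpha>. word_power T \<alpha> ` range (defect_star T))"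
  let ?M = "closed_cspan (\<Union>n. multi_power T n ` range (defect_star T))"
  let ?R = "closed_cspan (\<Union>z\<in>ball 0 1. inv (\<lambda>h. h - row_eval T z h) ` range (defect_star T))"
  have a: "CNC T \<longleftrightarrow> UNIV = ?W"
    using CNC_iff_words[OF assms(2)] by (simp only: eq_commute[of UNIV])
  have RW: "?R \<subseteq> ?W"
    by (rule resolvent_span_subset_word_span[OF assms(2)])
  have b: "CNC T \<longleftrightarrow> UNIV = ?M \<and> ?M = ?R" if "d_contraction T"
  proof -
    have comm: "\<And>i j. T i \<circ> T j = T j \<circ> T i"
      using that by (simp add: d_contraction_def)
    have MW: "?M = ?W"
      by (rule multi_span_eq_word_span) (rule comm)
    have "?W \<subseteq> ?R"
      by (rule word_span_subset_resolvent_span[OF assms(2)]) (rule comm)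
    with RW have RW': "?R = ?W"
      by (rule subset_antisym)
    show ?thesis
      by (simp only: a MW RW' simp_thms)
  qed
  \<comment> \<open>If the smaller span \<open>?R\<close> is the whole space, so is
    \<open>?W\<close>, and the word criterion applies.\<close>
  have c: "CNC T" if "UNIV = ?R"
    unfolding a using RW unfolding that[symmetric] by (rule subset_antisym) (rule subset_UNIV)
  show ?thesis
    by (intro conjI impI a b c)
qed

end
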